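(* Let $X$ be a hereditarily normal Hausdorff space such that $\psi(x,X) = \chi(x,X)$ for every point $x \in X$ and $|\overline{D}| \le 2^{c(X)}$ for every discrete set $D \subset X$. Then $|X| \le 2^{c(X)}$.
   Context: All spaces are assumed to be Hausdorff. A subset $D$ of $X$ is discrete if each of its points is isolated in the relative topology of $D$ ($D$ need not be closed in $X$). $\psi(x,X)$ (pseudocharacter at $x$) is the least cardinality of a family $\mathcal{U}$ of open subsets of $X$ with $\bigcap\mathcal{U} = \{x\}$. $\chi(x,X)$ (character at $x$) is the least cardinality of a local base at $x$. A cellular family is a family of pairwise disjoint non-empty open sets, and the cellularity is $c(X) = \sup\{|\mathcal{U}| : \mathcal{U} \text{ is a cellular family in } X\}$. *)

theory Defs
  imports "HOL-Analysis.Analysis"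
begin

unbundle cardinal_syntax
no_notation elt_set_eq (infix \<open>=o\<close> 50)

text \<open>
  Cardinals are the well-orders \<open>|A|\<close> of the HOL library, compared by \<open>\<le>o\<close> and \<open>=o\<close>; they are
  determined only up to \<open>=o\<close>. \<open>least_card F\<close> is the least cardinality of a member of \<open>F\<close>
  (meaningful for nonempty \<open>F\<close>), and \<open>sup_card F\<close> is the supremum of the cardinalities of the
  members of \<open>F\<close>. In \<open>sup_card\<close> it suffices to let the upper bounds range over sets \<open>K\<close> of the
  same type, as \<open>UNIV\<close> is one of them; by \<open>sup_card_least\<close> below the result is least among the
  upper bounds of every type.
\<close>

definition least_card :: "'b set set \<Rightarrow> 'b rel" where
  "least_card F = |SOME A. A \<in> F \<and> (\<forall>B\<in>F. |A| \<le>o |B| )|"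

definition sup_card :: "'b set set \<Rightarrow> 'b rel" where
  "sup_card F = least_card {K. \<forall>A\<in>F. |A| \<le>o |K|}"

lemma least_card_attained:
  assumes "F \<noteq> {}"
  shows "\<exists>A\<in>F. least_card F = |A| \<and> (\<forall>B\<in>F. |A| \<le>o |B| )"
proof -
  have "\<exists>r\<in>card_of ` F. \<forall>s\<in>card_of ` F. r \<le>o s"
    using assms by (intro exists_minim_Well_order) (auto simp: card_of_Well_order)
  then have "\<exists>A. A \<in> F \<and> (\<forall>B\<in>F. |A| \<le>o |B| )"
    by blast
  from someI_ex[OF this] show ?thesis
    unfolding least_card_def by blast
qed

lemma sup_card_attained:
  fixes F :: "'b set set"
  shows "\<exists>K. sup_card F = |K| \<and> (\<forall>A\<in>F. |A| \<le>o |K| )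
    \<and> (\<forall>L::'b set. (\<forall>A\<in>F. |A| \<le>o |L| ) \<longrightarrow> |K| \<le>o |L| )"
proof -
  have "(UNIV :: 'b set) \<in> {K. \<forall>A\<in>F. |A| \<le>o |K|}"
    by (simp add: card_of_mono1)
  then have "{K :: 'b set. \<forall>A\<in>F. |A| \<le>o |K|} \<noteq> {}"
    by blast
  from least_card_attained[OF this] show ?thesis
    unfolding sup_card_def by auto
qed

lemma sup_card_upper: "A \<in> F \<Longrightarrow> |A| \<le>o sup_card F"
  using sup_card_attained[of F] by auto

lemma sup_card_least:
  fixes F :: "'b set set" and L :: "'c set"
  assumes L: "\<And>A. A \<in> F \<Longrightarrow> |A| \<le>o |L|"
  shows "sup_card F \<le>o |L|"
proof -
  obtain K where K: "sup_card F = |K|"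
    and least: "\<And>M::'b set. \<forall>A\<in>F. |A| \<le>o |M| \<Longrightarrow> |K| \<le>o |M|"
    using sup_card_attained[of F] by auto
  show ?thesis
  proof (cases "|L| \<le>o |UNIV :: 'b set|")
    case True
    then obtain M :: "'b set" where M: "|L| =o |M|"
      using internalize_card_of_ordLeq[of L "|UNIV :: 'b set|"] by auto
    have "|K| \<le>o |M|"
      using L M by (intro least) (blast intro: ordLeq_ordIso_trans)
    then show ?thesis
      unfolding K using M ordIso_symmetric ordLeq_ordIso_trans by blast
  next
    case False
    then have "|UNIV :: 'b set| \<le>o |L|"
      using ordLeq_total[OF card_of_Well_order card_of_Well_order] by auto
    with card_of_mono1[OF subset_UNIV] show ?thesis
      unfolding K by (rule ordLeq_transitive)
  qed
qed

definition cellular_family :: "'a topology \<Rightarrow> 'a set set \<Rightarrow> bool" where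
  "cellular_family X \<U> \<longleftrightarrow> (\<forall>U\<in>\<U>. openin X U \<and> U \<noteq> {}) \<and> pairwise disjnt \<U>"

definition cellularity :: "'a topology \<Rightarrow> 'a set rel" where
  "cellularity X = sup_card {\<U>. cellular_family X \<U>}"

text \<open>
  The family in the definition of the pseudocharacter is required to be nonempty, so that no
  convention about \<open>\<Inter>{}\<close> intervenes; this matters only for one-point spaces.
\<close>

definition pseudochar :: "'a topology \<Rightarrow> 'a \<Rightarrow> 'a set rel" where
  "pseudochar X x = least_card {\<U>. \<U> \<noteq> {} \<and> (\<forall>U\<in>\<U>. openin X U) \<and> \<Inter>\<U> = {x}}"

definition local_base_at :: "'a topology \<Rightarrow> 'a \<Rightarrow> 'a set set \<Rightarrow> bool" where
  "local_base_at X x \<B> \<longleftrightarrow>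
    (\<forall>B\<in>\<B>. openin X B \<and> x \<in> B) \<and> (\<forall>U. openin X U \<and> x \<in> U \<longrightarrow> (\<exists>B\<in>\<B>. B \<subseteq> U))"

definition character_at :: "'a topology \<Rightarrow> 'a \<Rightarrow> 'a set rel" where
  "character_at X x = least_card {\<B>. local_base_at X x \<B>}"

definition discrete_in :: "'a topology \<Rightarrow> 'a set \<Rightarrow> bool" where
  "discrete_in X D \<longleftrightarrow> D \<subseteq> topspace X \<and> (\<forall>x\<in>D. openin (subtopology X D) {x})"

text \<open>
  Both least cardinalities are taken over nonempty collections: for the character always, for the
  pseudocharacter in Hausdorff spaces.
\<close>

lemma local_base_at_ex: "\<exists>\<B>. local_base_at X x \<B>"
  by (rule exI[of _ "{U. openin X U \<and> x \<in> U}"]) (auto simp: local_base_at_def)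

lemma pseudochar_family_ex:
  assumes "Hausdorff_space X" "x \<in> topspace X"
  shows "\<exists>\<U>. \<U> \<noteq> {} \<and> (\<forall>U\<in>\<U>. openin X U) \<and> \<Inter>\<U> = {x}"
proof -
  let ?\<U> = "{U. openin X U \<and> x \<in> U}"
  have top: "topspace X \<in> ?\<U>"
    using assms(2) by simp
  have "y = x" if y: "y \<in> \<Inter>?\<U>" for y
  proof (rule ccontr)
    assume "y \<noteq> x"
    moreover have "y \<in> topspace X"
      using y top by blast
    ultimately obtain U V where "openin X U" "openin X V" "x \<in> U" "y \<in> V" "disjnt U V"
      using assms unfolding Hausdorff_space_def by metis
    then show False
      using y by (auto simp: disjnt_iff)
  qed
  then have "\<Inter>?\<U> = {x}"
    by blast
  with top show ?thesis
    by (intro exI[of _ ?\<U>]) blast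
qed

end

theory Submission
  imports Defs
begin

text \<open>
  Let \<open>\<kappa> = c(X)\<close>. Every cover of a subspace by open sets admits a discrete set \<open>D\<close> whose closure,
  together with the members of the cover assigned to the points of \<open>D\<close>, covers the subspace. Applied
  to the complement of a point, this gives \<open>\<psi> \<le> 2^\<kappa>\<close>, hence \<open>\<chi> \<le> 2^\<kappa>\<close> at every point. With local
  bases of that size, hereditary normality and Jones' argument show that every discrete \<open>D\<close> is small,
  in the sense that \<open>2^|D| \<le> 2^\<kappa>\<close>. Now close off under two operations on small sets of pairs
  (point, basic neighbourhood): the closure of the points, if they form a discrete set, and a choice
  of a point outside this closure and the union of the neighbourhoods. The resulting set has size
  at most \<open>2^\<kappa>\<close>. If it missed a point \<open>p\<close>, cover it by basic neighbourhoods omitting \<open>p\<close>: the discrete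
  set of the first step is small, and the point chosen for it would lie in the set without being
  covered.
\<close>

section \<open>Small sets, namely those \<open>S\<close> with \<open>|Pow S| \<le>o |Pow K|\<close>:
  counting and closing off\<close>

lemma card_of_Pow_mono:
  assumes "|A| \<le>o |B|"
  shows "|Pow A| \<le>o |Pow B|"
proof -
  obtain f where f: "inj_on f A" "f ` A \<subseteq> B"
    using iffD2[OF card_of_ordLeq assms] by blast
  show ?thesis
    by (rule card_of_ordLeqI[where f = "image f"]) (use f inj_on_image_Pow in blast)+
qed

text \<open>With \<open>Z\<close> embedded in \<open>Pow K\<close>, a function is coded by a subset
  of \<open>A \<times> K\<close>. This product is no larger than its larger factor, and the power
  set of either factor has size at most \<open>|Pow K|\<close>.\<close>

lemma card_of_Func_ordLeq_Pow:
  assumes K: "infinite K" and A: "|Pow A| \<le>o |Pow K|" and Z: "|Z| \<le>o |Pow K|"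
  shows "|Func A Z| \<le>o |Pow K|"
proof -
  obtain g where g: "inj_on g Z" "g ` Z \<subseteq> Pow K"
    using iffD2[OF card_of_ordLeq Z] by blast
  define h where "h f = (SIGMA a:A. g (f a))" for f
  have "inj_on h (Func A Z)"
  proof (rule inj_onI)
    fix f f' assume f: "f \<in> Func A Z" "f' \<in> Func A Z" and eq: "h f = h f'"
    have "f a = f' a" if a: "a \<in> A" for a
    proof -
      have "g (f a) = h f `` {a}" "g (f' a) = h f' `` {a}"
        using a by (auto simp: h_def)
      then show ?thesis
        using eq g(1) f a by (auto simp: Func_def inj_on_def)
    qed
    \<comment> \<open>Outside \<open>A\<close> both functions have the value
      \<open>undefined\<close>.\<close>
    then show "f = f'"
      using f by (auto simp: Func_def fun_eq_iff) metis
  qed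
  moreover have "h f \<in> Pow (A \<times> K)" if "f \<in> Func A Z" for f
    using that g(2) by (fastforce simp: h_def Func_def)
  ultimately have 1: "|Func A Z| \<le>o |Pow (A \<times> K)|"
    by (rule card_of_ordLeqI)
  have "|Pow (A \<times> K)| \<le>o |Pow K|"
  proof (cases "|A| \<le>o |K|")
    case True
    then have "|A \<times> K| \<le>o |K|"
      using K True by (intro card_of_Times_ordLeq_infinite_Field)
        (simp_all add: Field_card_of card_of_card_order_on card_of_mono1)
    then show ?thesis
      by (rule card_of_Pow_mono)
  next
    case False
    then have KA: "|K| \<le>o |A|"
      using ordLeq_total[OF card_of_Well_order card_of_Well_order] by blast
    then have "|A \<times> K| \<le>o |A|"
      using K card_of_ordLeq_infinite[OF KA]
      by (intro card_of_Times_ordLeq_infinite_Field)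
        (simp_all add: Field_card_of card_of_card_order_on card_of_mono1 KA)
    from card_of_Pow_mono[OF this] A show ?thesis
      by (rule ordLeq_transitive)
  qed
  with 1 show ?thesis
    by (rule ordLeq_transitive)
qed

text \<open>By Cantor a small \<open>S\<close> has size below \<open>|Pow K|\<close>, so it is the
  image of an initial segment \<open>underS ?r a\<close>, again small. There are at most
  \<open>|Pow K|\<close> such segments, each with at most \<open>|Pow K|\<close> functions into
  \<open>Z\<close>.\<close>

lemma card_of_subsets_ordLeq_Pow:
  fixes K :: "'k set"
  assumes K: "infinite K" and Z: "|Z| \<le>o |Pow K|"
  shows "|{S. S \<subseteq> Z \<and> |Pow S| \<le>o |Pow K|}| \<le>o |Pow K|"
proof -
  let ?r = "|Pow K|"
  define I where "I = {a \<in> Pow K. |Pow (underS ?r a)| \<le>o ?r}"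
  have sub: "{S. S \<subseteq> Z \<and> |Pow S| \<le>o |Pow K|}
    \<subseteq> (\<Union>a\<in>I. (\<lambda>f. f ` underS ?r a) ` Func (underS ?r a) Z)"
  proof clarify
    fix S assume S: "S \<subseteq> Z" and small: "|Pow S| \<le>o |Pow K|"
    have "|S| <o |Pow K|"
      using card_of_Pow small ordLess_ordLeq_trans by blast
    then obtain a where "a \<in> Field ?r" and iso: "|S| =o Restr ?r (underS ?r a)"
      using iffD1[OF ordLess_iff_ordIso_Restr[OF card_of_Well_order card_of_Well_order]] by blast
    then have a: "a \<in> Pow K"
      by (simp only: Field_card_of)
    have "wo_rel.ofilter ?r (underS ?r a)"
      by (rule wo_rel.underS_ofilter) (simp only: wo_rel_def card_of_Well_order)
    then have "Field (Restr ?r (underS ?r a)) = underS ?r a"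
      by (rule Field_Restr_ofilter[OF card_of_Well_order])
    then have eq: "|S| =o |underS ?r a|"
      using card_of_cong[OF iso] by (simp only: Field_card_of)
    then have "|Pow (underS ?r a)| \<le>o |Pow S|"
      by (intro card_of_Pow_mono) (rule ordIso_imp_ordLeq[OF ordIso_symmetric])
    then have "a \<in> I"
      using a small ordLeq_transitive by (auto simp: I_def)
    obtain f where f: "bij_betw f (underS ?r a) S"
      using eq card_of_ordIso ordIso_symmetric by metis
    let ?f = "\<lambda>x. if x \<in> underS ?r a then f x else undefined"
    have "?f \<in> Func (underS ?r a) Z" "?f ` underS ?r a = S"
      using f S by (auto simp: Func_def bij_betw_def)
    then show "S \<in> (\<Union>a\<in>I. (\<lambda>f. f ` underS ?r a) ` Func (underS ?r a) Z)"
      using \<open>a \<in> I\<close> by blast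
  qed
  have "|\<Union>a\<in>I. (\<lambda>f. f ` underS ?r a) ` Func (underS ?r a) Z| \<le>o |Pow K|"
  proof (rule card_of_UNION_ordLeq_infinite)
    show "infinite (Pow K)"
      using K by simp
    show "|I| \<le>o |Pow K|"
      by (rule card_of_mono1) (auto simp: I_def)
    show "\<forall>a\<in>I. |(\<lambda>f. f ` underS ?r a) ` Func (underS ?r a) Z| \<le>o |Pow K|"
      using card_of_Func_ordLeq_Pow[OF K _ Z]
      by (auto simp: I_def intro: ordLeq_transitive[OF card_of_image])
  qed
  with card_of_mono1[OF sub] show ?thesis
    by (rule ordLeq_transitive)
qed

text \<open>Koenig's diagonal argument: \<open>Pow K\<close> enumerates the functions from \<open>S\<close> to \<open>Pow K\<close>.\<close>

lemma Pow_not_subset_UN_small: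
  fixes K :: "'k set"
  assumes K: "infinite K" and S: "|Pow S| \<le>o |Pow K|"
    and A: "\<And>s. s \<in> S \<Longrightarrow> |A s| <o |Pow K|"
  shows "\<not> Pow K \<subseteq> (\<Union>s\<in>S. A s)"
proof
  assume cover: "Pow K \<subseteq> (\<Union>s\<in>S. A s)"
  have "|Func S (Pow K)| \<le>o |Pow K|"
    using card_of_Func_ordLeq_Pow[OF K S card_of_mono1[OF order_refl]] .
  moreover have "Func S (Pow K) \<noteq> {}"
    by (auto simp: Func_is_emp)
  ultimately obtain e where e: "e ` Pow K = Func S (Pow K)"
    using card_of_ordLeq2 by metis
  \<comment> \<open>The functions \<open>e a\<close> with \<open>a \<in> A s\<close> take fewer than
    \<open>|Pow K|\<close> values at \<open>s\<close>, which leaves a value for the diagonal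
    function.\<close>
  have "\<exists>y\<in>Pow K. y \<notin> (\<lambda>a. e a s) ` A s" if "s \<in> S" for s
  proof (rule ccontr)
    assume "\<not> ?thesis"
    then have "Pow K \<subseteq> (\<lambda>a. e a s) ` A s"
      by blast
    from card_of_mono1[OF this] card_of_image have "|Pow K| \<le>o |A s|"
      by (rule ordLeq_transitive)
    then show False
      using not_ordLess_ordLeq[OF A[OF that]] by contradiction
  qed
  then obtain y where y: "\<And>s. s \<in> S \<Longrightarrow> y s \<in> Pow K \<and> y s \<notin> (\<lambda>a. e a s) ` A s"
    by metis
  let ?y = "\<lambda>s. if s \<in> S then y s else undefined"
  have "?y \<in> Func S (Pow K)"
    using y by (auto simp: Func_def)
  then have "?y \<in> e ` Pow K"
    by (simp only: e)
  then obtain a where a: "a \<in> Pow K" "e a = ?y"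
    by (rule imageE) (rule that, simp_all only:)
  then obtain s where s: "s \<in> S" "a \<in> A s"
    using cover by blast
  then have "e a s \<in> (\<lambda>a. e a s) ` A s"
    by blast
  then show False
    using y[OF s(1)] a s by auto
qed

text \<open>
  The closure is the union of a chain indexed by \<open>Pow K\<close> in its cardinal order; by Koenig, a set \<open>S\<close>
  with \<open>|Pow S| \<le>o |Pow K|\<close> already lies in an initial part of the chain.
\<close>

lemma closing_off:
  fixes K :: "'k set" and Op :: "'c set \<Rightarrow> 'c set"
  assumes K: "infinite K"
    and Op: "\<And>S. |Pow S| \<le>o |Pow K| \<Longrightarrow> |Op S| \<le>o |Pow K|"
  obtains H where "|H| \<le>o |Pow K|"
    and "\<And>S. S \<subseteq> H \<Longrightarrow> |Pow S| \<le>o |Pow K| \<Longrightarrow> Op S \<subseteq> H"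
proof -
  let ?r = "|Pow K|"
  have inf: "infinite (Pow K)"
    using K by simp
  have order: "trans ?r" "antisym ?r" "total_on (Pow K) ?r" "refl_on (Pow K) ?r"
    using card_of_well_order_on[of "Pow K"] by (simp_all only: order_on_defs)
  have wf: "wf (?r - Id)"
    using card_of_well_order_on[of "Pow K"] by (simp only: well_order_on_def)
  \<comment> \<open>One step of a transfinite recursion: stage \<open>x\<close> collects
    \<open>Op S\<close> for the small \<open>S\<close> inside the union of the earlier stages. Only
    predecessors of \<open>x\<close> are consulted, so \<open>cut\<close> is harmless below.\<close>
  define F where "F g x = \<Union>(Op ` {S. S \<subseteq> (\<Union>y\<in>underS ?r x. g y) \<and> |Pow S| \<le>o |Pow K|})"
    for g :: "'k set \<Rightarrow> 'c set" and x
  define G where "G = wfrec (?r - Id) F"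
  have G: "G x = F G x" for x
  proof -
    have "G x = F (cut G (?r - Id) x) x"
      unfolding G_def by (rule wfrec[OF wf])
    also have "(\<Union>y\<in>underS ?r x. cut G (?r - Id) x y) = (\<Union>y\<in>underS ?r x. G y)"
      by (auto simp: underS_def cut_apply)
    then have "F (cut G (?r - Id) x) x = F G x"
      by (simp add: F_def)
    finally show ?thesis .
  qed
  have card_G: "|G x| \<le>o |Pow K|" for x
  proof (induction x rule: wf_induct_rule[OF wf])
    case (1 x)
    have "|\<Union>y\<in>underS ?r x. G y| \<le>o |Pow K|"
    proof (rule card_of_UNION_ordLeq_infinite[OF inf])
      show "|underS ?r x| \<le>o |Pow K|"
        using card_of_mono1[OF Order_Relation.underS_Field[of ?r x]] by (simp only: Field_card_of)
      show "\<forall>y\<in>underS ?r x. |G y| \<le>o |Pow K|"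
        using 1 by (auto simp: underS_def)
    qed
    from card_of_subsets_ordLeq_Pow[OF K this]
    have "|\<Union>(Op ` {S. S \<subseteq> (\<Union>y\<in>underS ?r x. G y) \<and> |Pow S| \<le>o |Pow K|})| \<le>o |Pow K|"
      by (rule card_of_UNION_ordLeq_infinite[OF inf]) (auto intro: Op)
    then show ?case
      by (subst G) (simp add: F_def)
  qed
  show thesis
  proof
    show "|\<Union>x\<in>Pow K. G x| \<le>o |Pow K|"
      using card_G by (intro card_of_UNION_ordLeq_infinite[OF inf] card_of_mono1[OF order_refl]) blast
  next
    fix S assume S: "S \<subseteq> (\<Union>x\<in>Pow K. G x)" and small: "|Pow S| \<le>o |Pow K|"
    have "\<forall>s\<in>S. \<exists>x. x \<in> Pow K \<and> s \<in> G x"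
      using S by blast
    from bchoice[OF this] obtain \<rho> where \<rho>: "\<forall>s\<in>S. \<rho> s \<in> Pow K \<and> s \<in> G (\<rho> s)"
      by (rule exE)
    have "|under ?r (\<rho> s)| <o |Pow K|" if s: "s \<in> S" for s
    proof -
      \<comment> \<open>An infinite cardinal order has no last element; the closed segment up to
        \<open>\<rho> s\<close> thus fits in the open segment below a later \<open>b\<close>, whose
        size is less than \<open>|Pow K|\<close>.\<close>
      obtain b where b: "b \<in> Pow K" "\<rho> s \<noteq> b" "(\<rho> s, b) \<in> ?r"
        using infinite_Card_order_limit[of ?r, OF card_of_Card_order, unfolded Field_card_of, OF inf,
            OF conjunct1[OF bspec[OF \<rho> s]]] by (elim bexE conjE) (rule that)
      have "under ?r (\<rho> s) \<subseteq> underS ?r b"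
      proof
        fix c assume "c \<in> under ?r (\<rho> s)"
        then have c: "(c, \<rho> s) \<in> ?r"
          by (simp only: under_def mem_Collect_eq)
        then have "(c, b) \<in> ?r" "c \<noteq> b"
          using b transD[OF order(1) c b(3)] antisymD[OF order(2) b(3)] by fast+
        then show "c \<in> underS ?r b"
          by (simp add: underS_def)
      qed
      moreover have "|underS ?r b| <o ?r"
        using b(1) by (intro card_of_underS card_of_Card_order) (simp only: Field_card_of)
      ultimately show ?thesis
        using ordLeq_ordLess_trans[OF card_of_mono1] by fast
    qed
    \<comment> \<open>The index \<open>x\<close> lies above every \<open>\<rho> s\<close>, so all of
      \<open>S\<close> has appeared before stage \<open>x\<close>.\<close>
    from Pow_not_subset_UN_small[OF K small this]
    obtain x where x: "x \<in> Pow K" "x \<notin> (\<Union>s\<in>S. under ?r (\<rho> s))"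
      by (meson subsetI)
    have "\<rho> s \<in> underS ?r x" if s: "s \<in> S" for s
    proof -
      have "(x, \<rho> s) \<notin> ?r"
        using x(2) s by (simp add: under_def)
      moreover have "(x, x) \<in> ?r"
        by (rule refl_onD[OF order(4) x(1)])
      ultimately have "\<rho> s \<noteq> x"
        by metis
      moreover have "(\<rho> s, x) \<in> ?r"
        using order(3) x(1) conjunct1[OF bspec[OF \<rho> s]] \<open>\<rho> s \<noteq> x\<close> \<open>(x, \<rho> s) \<notin> ?r\<close>
        unfolding total_on_def by metis
      ultimately show ?thesis
        by (simp add: underS_def)
    qed
    then have "S \<subseteq> (\<Union>y\<in>underS ?r x. G y)"
      using \<rho> by blast
    then have "Op S \<subseteq> G x"
      using small by (subst G) (auto simp: F_def)
    then show "Op S \<subseteq> (\<Union>x\<in>Pow K. G x)"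
      using x(1) by blast
  qed
qed

section \<open>Cellularity, discrete sets and pseudocharacter\<close>

lemma least_card_ordLeq:
  assumes "A \<in> F"
  shows "least_card F \<le>o |A|"
proof -
  have "F \<noteq> {}"
    using assms by blast
  from least_card_attained[OF this] show ?thesis
    using assms by auto
qed

text \<open>Finitely many points of a Hausdorff space have pairwise disjoint neighbourhoods, so an
  infinite space has cellular families of every finite size.\<close>

lemma infinite_cellularity:
  fixes X :: "'a topology"
  assumes X: "Hausdorff_space X" and inf: "infinite (topspace X)" and K: "cellularity X = |K|"
  shows "infinite K"
proof
  assume "finite K"
  obtain F where F: "finite F" "card F = Suc (card K)" "F \<subseteq> topspace X"
    using infinite_arbitrarily_large[OF inf] by blast
  have "\<forall>x y. \<exists>U V. x \<in> topspace X \<and> y \<in> topspace X \<and> x \<noteq> y \<longrightarrow>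
      openin X U \<and> openin X V \<and> x \<in> U \<and> y \<in> V \<and> disjnt U V"
    using X unfolding Hausdorff_space_def by blast
  then obtain U V where UV: "\<And>x y. \<lbrakk>x \<in> topspace X; y \<in> topspace X; x \<noteq> y\<rbrakk> \<Longrightarrow>
      openin X (U x y) \<and> openin X (V x y) \<and> x \<in> U x y \<and> y \<in> V x y \<and> disjnt (U x y) (V x y)"
    by metis
  \<comment> \<open>\<open>N x\<close> lies in the separating sets chosen for both orders of each
    pair. The factor \<open>topspace X\<close> keeps it open when \<open>F\<close> is a
    singleton.\<close>
  define N where "N x = (\<Inter>y\<in>F - {x}. U x y \<inter> V y x) \<inter> topspace X" for x
  have N: "openin X (N x)" "x \<in> N x" if "x \<in> F" for x
  proof -
    have "openin X (U x y \<inter> V y x)" "x \<in> U x y \<inter> V y x" if "y \<in> F - {x}" for y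
      using UV[of x y] UV[of y x] that F(3) \<open>x \<in> F\<close> by auto
    then show "openin X (N x)" "x \<in> N x"
      using F that unfolding N_def by (auto intro!: openin_INT)
  qed
  have disj: "N x \<inter> N y = {}" if "x \<in> F" "y \<in> F" "x \<noteq> y" for x y
    using UV[of x y] UV[of y x] that F(3) unfolding N_def disjnt_def by blast
  have "cellular_family X (N ` F)"
    using N disj unfolding cellular_family_def pairwise_def disjnt_def by blast
  then have "|N ` F| \<le>o |K|"
    using sup_card_upper[of "N ` F" "{\<U>. cellular_family X \<U>}"] K
    by (simp add: cellularity_def)
  then obtain f where f: "inj_on f (N ` F)" "f ` N ` F \<subseteq> K"
    using iffD2[OF card_of_ordLeq] by blast
  have "inj_on N F"
    using N disj by (intro inj_onI) blast
  then have "card (N ` F) = Suc (card K)"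
    using F by (simp add: card_image)
  then show False
    using card_inj_on_le[OF f \<open>finite K\<close>] by simp
qed

text \<open>Take a maximal cellular family refining \<open>\<G>\<close> and, for each element, a
  member of \<open>\<G>\<close> containing it. A nonempty part of some \<open>G\<close> outside the
  closure of their union would extend the family.\<close>

lemma dense_subfamily_cellularity:
  assumes G: "\<forall>G\<in>\<G>. openin X G" and K: "cellularity X = |K|"
  shows "\<exists>\<W>\<subseteq>\<G>. |\<W>| \<le>o |K| \<and> \<Union>\<G> \<subseteq> X closure_of \<Union>\<W>"
proof -
  define \<A> where "\<A> = {\<U>. cellular_family X \<U> \<and> (\<forall>U\<in>\<U>. \<exists>G\<in>\<G>. U \<subseteq> G)}"
  have "\<exists>M\<in>\<A>. \<forall>\<U>\<in>\<A>. M \<subseteq> \<U> \<longrightarrow> \<U> = M"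
  proof (rule subset_Zorn')
    fix C assume C: "subset.chain \<A> C"
    then have "pairwise disjnt (\<Union>C)"
      by (intro pairwise_chain_Union)
        (auto simp: \<A>_def cellular_family_def subset.chain_def chains_def chain_subset_def)
    then show "\<Union>C \<in> \<A>"
      using C unfolding \<A>_def cellular_family_def subset.chain_def by blast
  qed
  then obtain M where M: "M \<in> \<A>" and max: "\<And>\<U>. \<lbrakk>\<U> \<in> \<A>; M \<subseteq> \<U>\<rbrakk> \<Longrightarrow> \<U> = M"
    by blast
  obtain g where g: "\<And>U. U \<in> M \<Longrightarrow> g U \<in> \<G> \<and> U \<subseteq> g U"
    using M unfolding \<A>_def mem_Collect_eq by metis
  let ?C = "X closure_of \<Union>(g ` M)"
  have "|M| \<le>o |K|"
    using sup_card_upper[of M "{\<U>. cellular_family X \<U>}"] K M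
    by (simp add: cellularity_def \<A>_def)
  then have "|g ` M| \<le>o |K|"
    by (rule ordLeq_transitive[OF card_of_image])
  moreover have "G \<subseteq> ?C" if "G \<in> \<G>" for G
  proof (rule ccontr)
    assume *: "\<not> G \<subseteq> ?C"
    have "\<Union>(g ` M) \<subseteq> ?C"
      using g G openin_subset by (intro closure_of_subset) blast
    then have disj: "U \<inter> (G - ?C) = {}" if "U \<in> M" for U
      using g[OF that] that by blast
    have "openin X (G - ?C)"
      using G that by (simp add: openin_diff)
    then have "insert (G - ?C) M \<in> \<A>"
      using M * disj that
      by (auto simp: \<A>_def cellular_family_def pairwise_insert disjnt_def)
    then have "G - ?C \<in> M"
      using max by blast
    then show False
      using disj * by blast
  qed
  ultimately show ?thesis
    using g by (intro exI[of _ "g ` M"]) blast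
qed

text \<open>
  A greedy choice along a well-order: the closure of the earlier points separates a chosen point
  from its predecessors, and its neighbourhood separates it from its successors.
\<close>

lemma discrete_selection:
  fixes X :: "'a topology"
  assumes Y: "Y \<subseteq> topspace X" and U: "\<And>y. y \<in> Y \<Longrightarrow> openin X (U y) \<and> y \<in> U y"
  shows "\<exists>D\<subseteq>Y. discrete_in X D \<and> Y \<subseteq> X closure_of D \<union> (\<Union>d\<in>D. U d)"
proof -
  define R where "R = |UNIV :: 'a set| - Id"
  have "well_order_on UNIV |UNIV :: 'a set|"
    by (rule card_of_well_order_on)
  then have wf: "wf R" and tot: "(x, y) \<in> R \<or> x = y \<or> (y, x) \<in> R" for x y
    by (simp_all add: R_def order_on_defs total_on_def) metis
  define F where "F p y \<longleftrightarrow> y \<in> Y \<and> y \<notin> X closure_of {d. (d, y) \<in> R \<and> p d} \<and>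
    (\<forall>d. (d, y) \<in> R \<and> p d \<longrightarrow> y \<notin> U d)" for p y
  define P where "P = wfrec R F"
  have P: "P y \<longleftrightarrow> F P y" for y
  proof -
    have "P y = F (cut P R y) y"
      unfolding P_def by (rule wfrec[OF wf])
    also have "\<dots> = F P y"
      unfolding F_def by (simp add: cut_apply cong: conj_cong)
    finally show ?thesis .
  qed
  define D where "D = {d. P d}"
  have PD: "y \<in> D \<longleftrightarrow> y \<in> Y \<and> y \<notin> X closure_of {d. (d, y) \<in> R \<and> d \<in> D} \<and>
      (\<forall>d. (d, y) \<in> R \<and> d \<in> D \<longrightarrow> y \<notin> U d)" for y
    using P[of y] by (simp add: D_def F_def)
  have DY: "D \<subseteq> Y"
    using PD by blast
  have "openin (subtopology X D) {y}" if y: "y \<in> D" for y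
  proof -
    let ?E = "{d. (d, y) \<in> R \<and> d \<in> D}"
    let ?O = "U y - X closure_of ?E"
    have "openin X ?O"
      using U[of y] y DY by (intro openin_diff closedin_closure_of) blast
    moreover have "?E \<subseteq> X closure_of ?E"
      using DY Y by (intro closure_of_subset) blast
    have "z = y" if z: "z \<in> D" "z \<in> ?O" for z
    proof -
      have "(z, y) \<notin> R"
        using z \<open>?E \<subseteq> X closure_of ?E\<close> by blast
      moreover have "(y, z) \<notin> R"
        using z y PD[of z] by blast
      ultimately show ?thesis
        using tot by blast
    qed
    then have "{y} = D \<inter> ?O"
      using y PD[of y] U[of y] by blast
    ultimately show ?thesis
      unfolding openin_subtopology by (intro exI[of _ ?O]) (simp add: Int_commute)
  qed
  then have "discrete_in X D"
    using DY Y by (auto simp: discrete_in_def)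
  moreover have "y \<in> X closure_of D \<union> (\<Union>d\<in>D. U d)" if y: "y \<in> Y" for y
  proof (rule ccontr)
    assume *: "y \<notin> X closure_of D \<union> (\<Union>d\<in>D. U d)"
    have "X closure_of {d. (d, y) \<in> R \<and> d \<in> D} \<subseteq> X closure_of D"
      by (rule closure_of_mono) blast
    \<comment> \<open>Missed by the closure of \<open>D\<close> and by all chosen neighbourhoods,
      \<open>y\<close> passes the selection test itself.\<close>
    then have "y \<in> D"
      using * y by (subst PD) blast
    moreover have "D \<subseteq> X closure_of D"
      using DY Y by (intro closure_of_subset) blast
    ultimately show False
      using * by blast
  qed
  ultimately show ?thesis
    using DY by blast
qed

text \<open>Disjoint subsets of a discrete set are separated, so hereditary normality gives disjoint
  open sets around \<open>A\<close> and \<open>D - A\<close>; the second misses the closure of the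
  first.\<close>

lemma discrete_in_separation:
  assumes X: "hereditarily normal_space X" and D: "discrete_in X D" and A: "A \<subseteq> D"
  shows "\<exists>W. openin X W \<and> A \<subseteq> W \<and> D \<inter> X closure_of W = A"
proof -
  have iso: "\<exists>Q. openin X Q \<and> Q \<inter> D = {x}" if x: "x \<in> D" for x
    using D x unfolding discrete_in_def openin_subtopology by metis
  have sep: "B \<inter> X closure_of C = {}" if "B \<subseteq> D" "C \<subseteq> D" "B \<inter> C = {}" for B C
  proof -
    have "x \<notin> X closure_of C" if x: "x \<in> B" for x
    proof -
      obtain Q where Q: "openin X Q" "Q \<inter> D = {x}"
        using iso[of x] x \<open>B \<subseteq> D\<close> by blast
      then have "x \<in> Q"
        by blast
      moreover have "Q \<inter> C \<subseteq> {x}"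
        unfolding Q(2)[symmetric] using \<open>C \<subseteq> D\<close> by (rule Int_mono[OF order_refl])
      moreover have "x \<notin> C"
        using x \<open>B \<inter> C = {}\<close> by blast
      ultimately show ?thesis
        using openin_Int_closure_of_eq_empty[OF Q(1), of C] by blast
    qed
    then show ?thesis
      by blast
  qed
  have "separatedin X A (D - A)"
    using D A sep[of A "D - A"] sep[of "D - A" A]
    unfolding separatedin_def discrete_in_def by blast
  from hereditarily_normal_separation[THEN iffD1, rule_format, OF X this]
  obtain W V where W: "openin X W" "openin X V" "A \<subseteq> W" "D - A \<subseteq> V" "disjnt W V"
    by (elim exE conjE) (rule that)
  then have "V \<inter> X closure_of W = {}"
    by (simp add: openin_Int_closure_of_eq_empty disjnt_def Int_commute)
  moreover have "W \<subseteq> X closure_of W"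
    using W by (simp add: closure_of_subset openin_subset)
  ultimately show ?thesis
    using W A by (intro exI[of _ W]) blast
qed

text \<open>
  Jones' counting argument: a subset \<open>A\<close> of \<open>D\<close> is recovered from at most \<open>|K|\<close> members of the local
  bases whose union is dense in the union of all those contained in a separating open set.
\<close>

lemma card_of_Pow_discrete:
  fixes X :: "'a topology"
  assumes X: "hereditarily normal_space X" and K: "cellularity X = |K|" "infinite K"
    and D: "discrete_in X D" "|D| \<le>o |Pow K|"
    and \<B>: "\<And>x. x \<in> D \<Longrightarrow> local_base_at X x (\<B> x)" "\<And>x. x \<in> D \<Longrightarrow> |\<B> x| \<le>o |Pow K|"
  shows "|Pow D| \<le>o |Pow K|"
proof -
  let ?B = "\<Union>x\<in>D. \<B> x"
  let ?S = "{S. S \<subseteq> ?B \<and> |Pow S| \<le>o |Pow K|}"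
  have "|?B| \<le>o |Pow K|"
    using K(2) D(2) \<B>(2) by (intro card_of_UNION_ordLeq_infinite ballI) (simp_all only: finite_Pow_iff not_False_eq_True)
  then have card_S: "|?S| \<le>o |Pow K|"
    by (rule card_of_subsets_ordLeq_Pow[OF K(2)])
  have ex: "\<exists>\<W>. \<W> \<in> ?S \<and> D \<inter> X closure_of \<Union>\<W> = A" if A: "A \<in> Pow D" for A
  proof -
    obtain W where W: "openin X W" "A \<subseteq> W" "D \<inter> X closure_of W = A"
      using discrete_in_separation[OF X D(1)] A by blast
    \<comment> \<open>Basic sets inside \<open>W\<close> still cover \<open>A\<close>, and their
      closure cannot meet \<open>D\<close> outside \<open>A\<close>.\<close>
    let ?G = "{B \<in> ?B. B \<subseteq> W}"
    have "\<forall>G\<in>?G. openin X G"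
      using \<B>(1) by (auto simp: local_base_at_def)
    from dense_subfamily_cellularity[OF this K(1)]
    obtain \<W> where \<W>: "\<W> \<subseteq> ?G" "|\<W>| \<le>o |K|" "\<Union>?G \<subseteq> X closure_of \<Union>\<W>"
      by (elim exE conjE) (rule that)
    have "A \<subseteq> X closure_of \<Union>\<W>"
    proof
      fix x assume x: "x \<in> A"
      then have xD: "x \<in> D"
        using A by blast
      with x obtain B where "B \<in> \<B> x" "x \<in> B" "B \<subseteq> W"
        using \<B>(1)[OF xD] W unfolding local_base_at_def by blast
      then show "x \<in> X closure_of \<Union>\<W>"
        using xD \<W>(3) by blast
    qed
    moreover have "X closure_of \<Union>\<W> \<subseteq> X closure_of W"
      using \<W>(1) by (intro closure_of_mono) blast
    ultimately have "D \<inter> X closure_of \<Union>\<W> = A"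
      using W A by blast
    moreover have "\<W> \<in> ?S"
      using \<W>(1) card_of_Pow_mono[OF \<W>(2)] by blast
    ultimately show ?thesis
      by blast
  qed
  from bchoice[OF ballI[OF ex]]
  obtain w where w: "\<forall>A\<in>Pow D. w A \<in> ?S \<and> D \<inter> X closure_of \<Union>(w A) = A"
    by (rule exE)
  have "inj_on w (Pow D)"
    by (rule inj_on_inverseI[where g = "\<lambda>\<W>. D \<inter> X closure_of \<Union>\<W>"])
      (rule conjunct2[OF bspec[OF w]])
  then have "|Pow D| \<le>o |?S|"
    by (rule card_of_ordLeqI) (rule conjunct1[OF bspec[OF w]])
  then show ?thesis
    using card_S by (rule ordLeq_transitive)
qed

text \<open>Select a discrete \<open>D\<close> in the complement of \<open>p\<close>. The sets
  \<open>V d\<close> exclude all points of the \<open>U d\<close>; the remaining points lie in the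
  closure of \<open>D\<close> and are removed one at a time.\<close>

lemma pseudochar_ordLeq_Pow:
  fixes X :: "'a topology"
  assumes X: "Hausdorff_space X" and K: "infinite K"
    and cl: "\<And>D. discrete_in X D \<Longrightarrow> |X closure_of D| \<le>o |Pow K|"
    and p: "p \<in> topspace X"
  shows "pseudochar X p \<le>o |Pow K|"
proof -
  have "\<forall>y. \<exists>U V. y \<in> topspace X - {p} \<longrightarrow>
      openin X U \<and> openin X V \<and> y \<in> U \<and> p \<in> V \<and> disjnt U V"
    using X p unfolding Hausdorff_space_def by blast
  then obtain U V where UV: "\<And>y. y \<in> topspace X - {p} \<Longrightarrow>
      openin X (U y) \<and> openin X (V y) \<and> y \<in> U y \<and> p \<in> V y \<and> disjnt (U y) (V y)"
    by metis
  obtain D where D: "D \<subseteq> topspace X - {p}" "discrete_in X D"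
      "topspace X - {p} \<subseteq> X closure_of D \<union> (\<Union>d\<in>D. U d)"
    using discrete_selection[of "topspace X - {p}" X U] UV by blast
  let ?C = "X closure_of D"
  \<comment> \<open>\<open>topspace X\<close> makes the family nonempty and confines its
    intersection to the space.\<close>
  let ?\<U> = "insert (topspace X) (V ` D \<union> (\<lambda>y. topspace X - {y}) ` (?C - {p}))"
  have "\<forall>W\<in>?\<U>. openin X W"
    using UV D(1) Hausdorff_imp_t1_space[OF X] closure_of_subset_topspace[of X D]
    by (auto simp: t1_space_openin_delete_alt intro: openin_topspace)
  moreover have "\<Inter>?\<U> = {p}"
  proof
    show "{p} \<subseteq> \<Inter>?\<U>"
      using p UV D(1) by auto
    show "\<Inter>?\<U> \<subseteq> {p}"
    proof
      fix y assume y: "y \<in> \<Inter>?\<U>"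
      show "y \<in> {p}"
      proof (rule ccontr)
        assume "y \<notin> {p}"
        moreover have "y \<notin> ?C - {p}"
          using y by blast
        ultimately obtain d where "d \<in> D" "y \<in> U d"
          using D(3) y by blast
        then show False
          using y UV[of d] D(1) by (auto simp: disjnt_iff)
      qed
    qed
  qed
  ultimately have "?\<U> \<in> {\<U>. \<U> \<noteq> {} \<and> (\<forall>U\<in>\<U>. openin X U) \<and> \<Inter>\<U> = {p}}"
    by blast
  then have "pseudochar X p \<le>o |?\<U>|"
    unfolding pseudochar_def by (rule least_card_ordLeq)
  moreover have "|?\<U>| \<le>o |Pow K|"
  proof -
    have inf: "infinite (Pow K)"
      using K by simp
    note Un_le = card_of_Un_ordLeq_infinite_Field[of "|Pow K|", unfolded Field_card_of,
        OF inf _ _ card_of_card_order_on]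
    have C: "|?C| \<le>o |Pow K|"
      by (rule cl[OF D(2)])
    have "D \<subseteq> ?C"
      using D(1) by (intro closure_of_subset) blast
    from card_of_mono1[OF this] C have "|D| \<le>o |Pow K|"
      by (rule ordLeq_transitive)
    then have 1: "|V ` D| \<le>o |Pow K|"
      by (rule ordLeq_transitive[OF card_of_image])
    have "|?C - {p}| \<le>o |?C|"
      by (rule card_of_mono1) blast
    from ordLeq_transitive[OF card_of_image ordLeq_transitive[OF this C]]
    have 2: "|(\<lambda>y. topspace X - {y}) ` (?C - {p})| \<le>o |Pow K|" .
    have 3: "|{topspace X}| \<le>o |Pow K|"
      using inf by (intro card_of_singl_ordLeq) auto
    show ?thesis
      by (subst insert_is_Un) (rule Un_le, rule 3, rule Un_le, rule 1, rule 2)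
  qed
  ultimately show ?thesis
    by (rule ordLeq_transitive)
qed


section \<open>The finite case and the closing-off argument\<close>

lemma finite_Hausdorff_discrete_in:
  assumes "Hausdorff_space X" "finite (topspace X)"
  shows "discrete_in X (topspace X)"
proof -
  have "openin X {x}" if x: "x \<in> topspace X" for x
  proof -
    have "closedin X (topspace X - {x})"
      using assms Hausdorff_imp_t1_space[OF assms(1)] by (simp add: t1_space_closedin_finite)
    moreover have "topspace X - (topspace X - {x}) = {x}"
      using x by blast
    ultimately show ?thesis
      by (metis openin_diff openin_topspace)
  qed
  then show ?thesis
    by (simp add: discrete_in_def)
qed

theorem theorem3p2:
  fixes X :: "'a topology"
  assumes "Hausdorff_space X"
    and "hereditarily normal_space X"
    and "\<And>x. x \<in> topspace X \<Longrightarrow> pseudochar X x =o character_at X x"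
    and "\<And>D. discrete_in X D \<Longrightarrow> |X closure_of D| \<le>o ctwo ^c cellularity X"
  shows "|topspace X| \<le>o ctwo ^c cellularity X"
proof (cases "finite (topspace X)")
  case True
  \<comment> \<open>The whole space is discrete and is its own closure.\<close>
  from assms(4)[OF finite_Hausdorff_discrete_in[OF assms(1) True]] show ?thesis
    by simp
next
  case False
  obtain K where K: "cellularity X = |K|"
    using sup_card_attained unfolding cellularity_def by blast
  have inf: "infinite K" "infinite (Pow K)"
    using infinite_cellularity[OF assms(1) False K] by simp_all
  have two: "|Pow K| =o ctwo ^c cellularity X"
    unfolding K ctwo_def cexp_def Field_card_of by (rule card_of_Pow_Func)
  have cl: "|X closure_of D| \<le>o |Pow K|" if "discrete_in X D" for D
    using assms(4)[OF that] ordIso_symmetric[OF two] by (rule ordLeq_ordIso_trans)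
  \<comment> \<open>The equality of pseudocharacter and character turns the bound on the former into
    small enough local bases.\<close>
  have "\<exists>\<B>. local_base_at X x \<B> \<and> |\<B>| \<le>o |Pow K|" if x: "x \<in> topspace X" for x
  proof -
    have "character_at X x \<le>o |Pow K|"
      using ordIso_symmetric[OF assms(3)[OF x]] pseudochar_ordLeq_Pow[OF assms(1) inf(1) cl x]
      by (rule ordIso_ordLeq_trans)
    moreover have "{\<B>. local_base_at X x \<B>} \<noteq> {}"
      using local_base_at_ex[of X x] by simp
    ultimately show ?thesis
      using least_card_attained[of "{\<B>. local_base_at X x \<B>}"]
      unfolding character_at_def by auto
  qed
  then obtain \<B> where \<B>: "\<And>x. x \<in> topspace X \<Longrightarrow> local_base_at X x (\<B> x)"
      "\<And>x. x \<in> topspace X \<Longrightarrow> |\<B> x| \<le>o |Pow K|"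
    by metis
  have small: "|Pow D| \<le>o |Pow K|" if D: "discrete_in X D" for D
  proof (rule card_of_Pow_discrete[OF assms(2) K inf(1) D, where \<B> = \<B>])
    have sub: "D \<subseteq> topspace X"
      using D by (simp add: discrete_in_def)
    show "|D| \<le>o |Pow K|"
      using card_of_mono1[OF closure_of_subset[OF sub]] cl[OF D] by (rule ordLeq_transitive)
    show "local_base_at X x (\<B> x)" "|\<B> x| \<le>o |Pow K|" if "x \<in> D" for x
      using \<B> sub that by blast+
  qed
  \<comment> \<open>A set \<open>S\<close> of pairs encodes a candidate cover; a point of
    \<open>rest S\<close> witnesses that it fails.\<close>
  define rest where "rest S = topspace X - (X closure_of (fst ` S) \<union> \<Union>(snd ` S))"
    for S :: "('a \<times> 'a set) set"
  define new where "new S = (if discrete_in X (fst ` S) then X closure_of (fst ` S) else {})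
    \<union> (if rest S = {} then {} else {SOME x. x \<in> rest S})" for S
  have new_sub: "new S \<subseteq> topspace X" for S
    using closure_of_subset_topspace[of X "fst ` S"] some_in_eq[of "rest S"]
    by (auto simp: new_def rest_def split: if_splits)
  have "|new S| \<le>o |Pow K|" for S
    unfolding new_def
  proof (rule card_of_Un_ordLeq_infinite_Field[of "|Pow K|", unfolded Field_card_of,
        OF inf(2) _ _ card_of_card_order_on])
    show "|if discrete_in X (fst ` S) then X closure_of (fst ` S) else {}| \<le>o |Pow K|"
      using cl[of "fst ` S"] card_of_empty by (cases "discrete_in X (fst ` S)") simp_all
    show "|if rest S = {} then {} else {SOME x. x \<in> rest S}| \<le>o |Pow K|"
      using card_of_empty card_of_singl_ordLeq[OF Pow_not_empty] by (cases "rest S = {}") simp_all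
  qed
  then have "|Sigma (new S) \<B>| \<le>o |Pow K|" for S
    using \<B>(2) new_sub by (intro card_of_Sigma_ordLeq_infinite[OF inf(2)]) blast+
  then obtain H where H: "|H| \<le>o |Pow K|"
    and closed: "\<And>S. S \<subseteq> H \<Longrightarrow> |Pow S| \<le>o |Pow K| \<Longrightarrow> Sigma (new S) \<B> \<subseteq> H"
    using closing_off[OF inf(1), of "\<lambda>S. Sigma (new S) \<B>"] by metis
  \<comment> \<open>Requiring all pairs over \<open>x\<close> ensures that any choice of basic
    neighbourhoods for points of \<open>Y\<close> stays in \<open>H\<close>.\<close>
  define Y where "Y = {x \<in> topspace X. {x} \<times> \<B> x \<subseteq> H}"
  have new_Y: "new S \<subseteq> Y" if "S \<subseteq> H" "|Pow S| \<le>o |Pow K|" for S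
    using closed[OF that] new_sub[of S] by (auto simp: Y_def)
  have "Y = topspace X"
  proof (rule ccontr)
    assume "Y \<noteq> topspace X"
    then obtain p where p: "p \<in> topspace X" "p \<notin> Y"
      by (auto simp: Y_def)
    have "\<exists>B\<in>\<B> y. p \<notin> B" if y: "y \<in> Y" for y
    proof -
      have "y \<in> topspace X" "y \<noteq> p"
        using y p by (auto simp: Y_def)
      then obtain U where "openin X U" "y \<in> U" "p \<notin> U"
        using Hausdorff_imp_t1_space[OF assms(1)] p(1) unfolding t1_space_def by blast
      then show ?thesis
        using \<B>(1)[OF \<open>y \<in> topspace X\<close>] unfolding local_base_at_def by blast
    qed
    then obtain U where U: "\<And>y. y \<in> Y \<Longrightarrow> U y \<in> \<B> y \<and> p \<notin> U y"
      by metis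
    have "openin X (U y) \<and> y \<in> U y" if "y \<in> Y" for y
      using U[OF that] \<B>(1)[of y] that by (auto simp: Y_def local_base_at_def)
    then obtain D where D: "D \<subseteq> Y" "discrete_in X D" "Y \<subseteq> X closure_of D \<union> (\<Union>d\<in>D. U d)"
      using discrete_selection[of Y X U] unfolding Y_def by blast
    define S where "S = (\<lambda>d. (d, U d)) ` D"
    have S: "fst ` S = D" "snd ` S = U ` D"
      by (auto simp: S_def image_image)
    have "(d, U d) \<in> H" if "d \<in> D" for d
      using subsetD[OF D(1) that] U[of d] unfolding Y_def by blast
    then have "S \<subseteq> H"
      by (auto simp: S_def)
    moreover have "|Pow S| \<le>o |Pow K|"
      using card_of_Pow_mono[OF card_of_image] small[OF D(2)]
      unfolding S_def by (rule ordLeq_transitive)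
    ultimately have sub: "new S \<subseteq> Y"
      by (rule new_Y)
    then have "X closure_of D \<subseteq> Y"
      using D(2) by (auto simp: new_def S)
    then have "p \<in> rest S"
      using p U D(1) by (auto simp: rest_def S)
    \<comment> \<open>Since \<open>p\<close> is uncovered, \<open>new S\<close> contains a chosen
      uncovered point. It lies in \<open>Y\<close>, which \<open>D\<close> and \<open>U\<close>
      cover.\<close>
    then have "(SOME x. x \<in> rest S) \<in> rest S" "(SOME x. x \<in> rest S) \<in> new S"
      by (auto simp: new_def some_in_eq)
    then show False
      using sub D(3) by (auto simp: rest_def S)
  qed
  \<comment> \<open>Local bases are nonempty, so each point of \<open>Y\<close> occurs in a pair of
    \<open>H\<close>.\<close>
  have "Y \<subseteq> fst ` H"
  proof
    fix x assume x: "x \<in> Y"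
    then obtain B where "B \<in> \<B> x"
      using \<B>(1)[of x] unfolding local_base_at_def Y_def by blast
    then show "x \<in> fst ` H"
      using x by (force simp: Y_def)
  qed
  then have "|topspace X| \<le>o |fst ` H|"
    unfolding \<open>Y = topspace X\<close> by (rule card_of_mono1)
  from ordLeq_transitive[OF this ordLeq_transitive[OF card_of_image H]]
  show ?thesis
    using two by (rule ordLeq_ordIso_trans)
qed

end
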